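(* Let $n \ge 1$ and let $\nu = (\nu_B)_{B \in S_{n-1}}$ be a family of probability measures on $\mathbb{Z}_+$ with $\sum_{y \in B} \nu_B(y) = 0$ for all $B \in S_{n-1}$. Assume that the family is uniformly integrable, i.e. $$\sup_{B \in S_{n-1}} \sum_{x > K} x\, \nu_B(x) \to 0 \quad \text{as } K \to \infty,$$ and that $$\nu_B(\min(B^c)) > 0 \quad \text{for all } B \in S_{n-1}.$$ Then the juggler's exclusion process on $S_n$ generated by $(\nu_B)$ has a unique equilibrium distribution $\pi$, and the process started from any initial configuration converges in total variation to $\pi$ as time tends to infinity, i.e. for every $A \in S_n$, $\sum_{B \in S_n} |P^t(A,B) - \pi(B)| \to 0$ as $t \to \infty$.
   Context: $\mathbb{Z}_+ = \{0,1,2,\dots\}$; $S_m$ is the countable set of $m$-element subsets of $\mathbb{Z}_+$ ($S_0 = \{\emptyset\}$). For a set $A$ of integers, $A - 1 = \{a-1 : a \in A\}$; for finite nonempty $A$, $A^* = A \setminus \{\min A\}$. $B^c = \mathbb{Z}_+ \setminus B$. The juggler's exclusion process (JEP) with $n$ particles generated by $(\nu_B)_{B \in S_{n-1}}$ is the discrete-time Markov chain on $S_n$ with transition matrix $$P(A,B) = \begin{cases} 1, & 0 \notin A,\ B = A-1, \\ \nu_{A^*-1}(y), & 0 \in A,\ B = (A^*-1) \cup \{y\} \text{ with } y \notin A^*-1, \\ 0, & \text{otherwise.}\end{cases}$$ An equilibrium distribution is a probability measure $\pi$ on $S_n$ with $\pi P = \pi$. $P^t$ denotes the $t$-step transition matrix.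 *)

theory Defs
  imports "HOL-Probability.Probability"
begin

definition configs :: "nat \<Rightarrow> nat set set" where
  "configs m = {A. finite A \<and> card A = m}"

text \<open>Subtraction on \<open>nat\<close> truncates, so this is \<open>A - 1\<close> only for \<open>0 \<notin> A\<close>; it is applied
  to such sets only.\<close>

definition shift_down :: "nat set \<Rightarrow> nat set" where
  "shift_down A = (\<lambda>a. a - 1) ` A"

definition remove_min :: "nat set \<Rightarrow> nat set" where
  "remove_min A = A - {Min A}"

text \<open>A family of probability measures on the non-negative integers indexed by \<open>configs m\<close> is
  a total function \<open>\<nu>\<close>, of which only the values on \<open>configs m\<close> matter.  In the second case
  below, the integer \<open>y\<close> is determined by \<open>A\<close> and \<open>B\<close>.\<close>

definition jep_matrix :: "(nat set \<Rightarrow> nat pmf) \<Rightarrow> nat set \<Rightarrow> nat set \<Rightarrow> real" where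
  "jep_matrix \<nu> A B =
     (let C = shift_down (remove_min A) in
      if 0 \<notin> A \<and> B = shift_down A then 1
      else if 0 \<in> A \<and> (\<exists>y. y \<notin> C \<and> B = C \<union> {y})
        then pmf (\<nu> C) (THE y. y \<notin> C \<and> B = C \<union> {y})
      else 0)"

text \<open>If each \<open>\<nu> B\<close> gives no mass to \<open>B\<close>, the rows of the transition matrix are probability
  vectors on \<open>configs n\<close>, so the unconditional sums below are all convergent (and never take the
  default value \<open>0\<close> of a divergent \<open>infsum\<close>).\<close>

fun jep_power ::
  "nat \<Rightarrow> (nat set \<Rightarrow> nat pmf) \<Rightarrow> nat \<Rightarrow> nat set \<Rightarrow> nat set \<Rightarrow> real" where
  "jep_power n \<nu> 0 A B = (if A = B then 1 else 0)"
| "jep_power n \<nu> (Suc t) A B =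
     (\<Sum>\<^sub>\<infinity>C\<in>configs n. jep_power n \<nu> t A C * jep_matrix \<nu> C B)"

definition equilibrium ::
  "nat \<Rightarrow> (nat set \<Rightarrow> nat pmf) \<Rightarrow> nat set pmf \<Rightarrow> bool" where
  "equilibrium n \<nu> \<pi> \<longleftrightarrow> set_pmf \<pi> \<subseteq> configs n \<and>
     (\<forall>B\<in>configs n. (\<Sum>\<^sub>\<infinity>A\<in>configs n. pmf \<pi> A * jep_matrix \<nu> A B) = pmf \<pi> B)"

text \<open>The supremum is taken in \<open>[0,\<infinity>]\<close>, as the tail sums may be infinite or unbounded.\<close>

definition uniformly_integrable_family ::
  "nat \<Rightarrow> (nat set \<Rightarrow> nat pmf) \<Rightarrow> bool" where
  "uniformly_integrable_family m \<nu> \<longleftrightarrow>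
     (\<lambda>K::nat. SUP B\<in>configs m. \<Sum>\<^sub>\<infinity>x\<in>{K<..}. of_nat x * ennreal (pmf (\<nu> B) x))
       \<longlonglongrightarrow> 0"

end

theory Submission
  imports Defs "HOL-Complex_Analysis.Great_Picard"
begin

text \<open>
  The process is handled as a Markov chain with a Foster-Lyapunov function, namely the position
  of the highest particle.  One step lowers the maximum \<open>m\<close> by 1 unless the thrown particle lands
  above \<open>m - 1\<close>; by uniform integrability the expected overshoot is at most 1/2 once \<open>m\<close> is large.
  So the maximum has expected drift at most -1/2 outside the finite set of configurations with a
  small maximum (\<open>height_after_step\<close>).  The positivity assumption permits every throw to the least
  free height.  Such throws lead from any configuration to the ground state \<open>{0, \<dots>, n - 1}\<close>, because
  they decrease the sum of all heights (\<open>reach_ground\<close>), and they keep the ground state where it is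
  (\<open>ground_self_loop\<close>).

  The rest concerns any chain with such a drift and an atom with a self-loop that is reachable from
  everywhere (the locale \<open>foster_chain\<close>).  A stationary distribution arises as a limit of occupation
  measures of the walk from the atom: the drift forces a positive fraction of time to be spent in
  the finite set, so not all mass escapes (\<open>exists_stationary\<close>).

  A linear drift alone gives no geometric contraction, so convergence is obtained softly, from
  the limit superior of the distances between the laws of two walks.  It is a bounded
  subharmonic function for two independent copies of the chain.  Under a stationary law the zeros
  of such a function in the support are closed under transitions, and it is zero when both copies
  start in the atom.  Hence walks started in the atom and in any state reachable from it merge
  (\<open>merging_from_atom\<close>), and averaging over the stationary distribution shows that the walk from the
  atom converges.  For an arbitrary starting point, the limiting distance to equilibrium is again
  bounded and subharmonic and vanishes at the atom; the drift and the finite set provide a maximum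
  principle that makes it zero everywhere (\<open>subharmonic_eq_0\<close>).  Uniqueness follows from convergence.
\<close>

section \<open>Total variation distance of discrete distributions\<close>

definition l1_dist :: "'a pmf \<Rightarrow> 'a pmf \<Rightarrow> ennreal" where
  "l1_dist p q = (\<integral>\<^sup>+x. ennreal \<bar>pmf p x - pmf q x\<bar> \<partial>count_space UNIV)"

lemma l1_dist_self [simp]: "l1_dist p p = 0"
  by (simp add: l1_dist_def)

lemma l1_dist_eq_0D:
  assumes "l1_dist p q = 0" shows "p = q"
proof (rule pmf_eqI)
  fix x
  have "AE x in count_space UNIV. ennreal \<bar>pmf p x - pmf q x\<bar> = 0"
    using assms unfolding l1_dist_def by (subst (asm) nn_integral_0_iff_AE) auto
  then show "pmf p x = pmf q x"
    by (auto simp: AE_count_space)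
qed

lemma l1_dist_le_2: "l1_dist p q \<le> 2"
proof -
  have "l1_dist p q \<le> (\<integral>\<^sup>+x. ennreal (pmf p x) + ennreal (pmf q x) \<partial>count_space UNIV)"
    unfolding l1_dist_def
    by (intro nn_integral_mono) (auto simp flip: ennreal_plus intro!: ennreal_leI abs_leI)
  also have "\<dots> = 1 + 1"
    by (subst nn_integral_add) (auto simp: nn_integral_pmf)
  finally show ?thesis by simp
qed

text \<open>The distance is the norm of a signed measure, hence convex.  Applied to a coupling \<open>M\<close> of the
  first steps of two walks, this bounds the distance after \<open>t + 1\<close> steps by the mean distance
  after \<open>t\<close> steps.\<close>

lemma l1_dist_bind_le:
  fixes M :: "'a pmf" and f h :: "'a \<Rightarrow> 'b pmf"
  shows "l1_dist (bind_pmf M f) (bind_pmf M h) \<le> (\<integral>\<^sup>+x. l1_dist (f x) (h x) \<partial>measure_pmf M)"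
proof -
  \<comment> \<open>At each point, the triangle inequality for the integral; the sum over points is then exchanged
    with the integral by Tonelli.\<close>
  have pointwise: "ennreal \<bar>pmf (bind_pmf M f) y - pmf (bind_pmf M h) y\<bar>
      \<le> (\<integral>\<^sup>+x. ennreal \<bar>pmf (f x) y - pmf (h x) y\<bar> \<partial>measure_pmf M)" for y
  proof -
    have int: "integrable (measure_pmf M) (\<lambda>x. pmf (F x) y)" for F :: "'a \<Rightarrow> 'b pmf"
      by (rule measure_pmf.integrable_const_bound[where B=1]) (auto simp: pmf_le_1)
    have "\<bar>pmf (bind_pmf M f) y - pmf (bind_pmf M h) y\<bar>
        = \<bar>\<integral>x. pmf (f x) y - pmf (h x) y \<partial>measure_pmf M\<bar>"
      by (simp add: pmf_bind int)
    also have "\<dots> \<le> (\<integral>x. \<bar>pmf (f x) y - pmf (h x) y\<bar> \<partial>measure_pmf M)"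
      by (rule integral_abs_bound)
    finally have "ennreal \<bar>pmf (bind_pmf M f) y - pmf (bind_pmf M h) y\<bar>
        \<le> ennreal (\<integral>x. \<bar>pmf (f x) y - pmf (h x) y\<bar> \<partial>measure_pmf M)"
      by (rule ennreal_leI)
    also have "\<dots> = (\<integral>\<^sup>+x. ennreal \<bar>pmf (f x) y - pmf (h x) y\<bar> \<partial>measure_pmf M)"
      by (rule nn_integral_eq_integral[symmetric]) (auto simp: int)
    finally show ?thesis .
  qed
  have "l1_dist (bind_pmf M f) (bind_pmf M h)
      \<le> (\<integral>\<^sup>+y. \<integral>\<^sup>+x. ennreal \<bar>pmf (f x) y - pmf (h x) y\<bar> \<partial>measure_pmf M \<partial>count_space UNIV)"
    unfolding l1_dist_def by (intro nn_integral_mono pointwise)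
  also have "\<dots> = (\<integral>\<^sup>+y. \<integral>\<^sup>+x. ennreal (pmf M x) * ennreal \<bar>pmf (f x) y - pmf (h x) y\<bar>
      \<partial>count_space UNIV \<partial>count_space UNIV)"
    by (simp add: nn_integral_measure_pmf)
  also have "\<dots> = (\<integral>\<^sup>+x. \<integral>\<^sup>+y. ennreal (pmf M x) * ennreal \<bar>pmf (f x) y - pmf (h x) y\<bar>
      \<partial>count_space UNIV \<partial>count_space UNIV)"
    using nn_integral_fst_count_space[of "\<lambda>(x,y). ennreal (pmf M x) * ennreal \<bar>pmf (f x) y - pmf (h x) y\<bar>"]
      nn_integral_snd_count_space[of "\<lambda>(x,y). ennreal (pmf M x) * ennreal \<bar>pmf (f x) y - pmf (h x) y\<bar>"]
    by simp
  also have "\<dots> = (\<integral>\<^sup>+x. l1_dist (f x) (h x) \<partial>measure_pmf M)"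
    by (simp add: nn_integral_measure_pmf l1_dist_def nn_integral_cmult)
  finally show ?thesis .
qed

text \<open>Reverse Fatou: under a probability measure a constant bound is an integrable majorant.\<close>

lemma limsup_nn_integral_pmf_le:
  fixes u :: "nat \<Rightarrow> 'a \<Rightarrow> ennreal"
  assumes "\<And>t x. u t x \<le> C" "C < \<infinity>"
  shows "limsup (\<lambda>t. \<integral>\<^sup>+x. u t x \<partial>measure_pmf M) \<le> (\<integral>\<^sup>+x. limsup (\<lambda>t. u t x) \<partial>measure_pmf M)"
  using assms by (intro nn_integral_limsup[where w="\<lambda>_. C"]) auto

lemma limsup_le_const:
  fixes u :: "nat \<Rightarrow> ennreal"
  assumes "\<And>t. u t \<le> C" shows "limsup u \<le> C"
  by (rule Limsup_bounded) (auto simp: assms)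

text \<open>Both distributions have total mass 1, so a strict inequality at one point could not be
  made up for elsewhere.  This turns the one-sided bound that Fatou's lemma gives for a limit of
  occupation measures into an equality.\<close>

lemma pmf_eqI_le:
  assumes "\<And>x. pmf p x \<le> pmf q x" shows "p = q"
proof (rule pmf_eqI, rule ccontr)
  fix x assume "pmf p x \<noteq> pmf q x"
  with assms[of x] have less: "pmf p x < pmf q x" by simp
  have "1 = measure p {x} + measure p (- {x})"
    using measure_pmf.prob_compl[of "{x}" p] by (simp add: Compl_eq_Diff_UNIV)
  also have "\<dots> < measure q {x} + measure q (- {x})"
  proof -
    have "emeasure p (- {x}) \<le> emeasure q (- {x})"
      unfolding nn_integral_pmf[symmetric] by (intro nn_integral_mono ennreal_leI assms)
    then have "measure p (- {x}) \<le> measure q (- {x})"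
      by (simp add: measure_pmf.emeasure_eq_measure)
    then show ?thesis using less by (simp add: measure_pmf_single)
  qed
  also have "\<dots> = 1"
    using measure_pmf.prob_compl[of "{x}" q] by (simp add: Compl_eq_Diff_UNIV)
  finally show False by simp
qed

lemma ennreal_multiples_bounded:
  fixes a B :: ennreal
  assumes "\<And>t::nat. of_nat t * a \<le> B" "B < \<infinity>"
  shows "a = 0"
proof (rule ccontr)
  assume "a \<noteq> 0"
  have "a \<le> B" using assms(1)[of 1] by simp
  then have "a < \<infinity>" using \<open>B < \<infinity>\<close> by (rule le_less_trans)
  then obtain a' where a': "a = ennreal a'" "a' > 0"
    using \<open>a \<noteq> 0\<close> by (cases a) (auto simp: ennreal_eq_0_iff not_le)
  obtain B' where B': "B = ennreal B'" "B' \<ge> 0" using \<open>B < \<infinity>\<close> by (cases B) auto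
  obtain t :: nat where "B' < real t * a'" using reals_Archimedean3[OF \<open>a' > 0\<close>] by blast
  then have "B < of_nat t * a"
    using a' B' by (simp add: ennreal_of_nat_eq_real_of_nat ennreal_mult[symmetric] ennreal_less_iff)
  with assms(1)[of t] show False by simp
qed

section \<open>Subharmonic functions under a stationary distribution\<close>

text \<open>In equilibrium \<open>f\<close> and its one-step mean have the same finite integral, so a subharmonic \<open>f\<close>
  coincides with its one-step mean on the support of \<open>M\<close>.  At a zero of \<open>f\<close> the mean is therefore
  zero, and \<open>f\<close> vanishes at every possible successor.\<close>

lemma subharmonic_zeros_closed:
  fixes f :: "'a \<Rightarrow> ennreal"
  assumes stat: "bind_pmf M K = M"
    and bdd: "\<And>x. f x \<le> C" "C < \<infinity>"
    and sub: "\<And>x. f x \<le> (\<integral>\<^sup>+y. f y \<partial>measure_pmf (K x))"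
    and x: "x \<in> set_pmf M" "f x = 0" and y: "y \<in> set_pmf (K x)"
  shows "f y = 0"
proof -
  let ?Pf = "\<lambda>x. \<integral>\<^sup>+y. f y \<partial>measure_pmf (K x)"
  have "(\<integral>\<^sup>+x. f x \<partial>measure_pmf M) \<le> (\<integral>\<^sup>+x. C \<partial>measure_pmf M)"
    by (intro nn_integral_mono bdd)
  with bdd(2) have fin: "(\<integral>\<^sup>+x. f x \<partial>measure_pmf M) \<noteq> \<infinity>" by auto
  have "(\<integral>\<^sup>+x. ?Pf x - f x \<partial>measure_pmf M)
      = (\<integral>\<^sup>+x. ?Pf x \<partial>measure_pmf M) - (\<integral>\<^sup>+x. f x \<partial>measure_pmf M)"
    using fin sub by (intro nn_integral_diff) auto
  also have "(\<integral>\<^sup>+x. ?Pf x \<partial>measure_pmf M) = (\<integral>\<^sup>+x. f x \<partial>measure_pmf M)"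
    using nn_integral_bind_pmf[where f=f and M=M and N=K] stat by simp
  finally have "(\<integral>\<^sup>+x. ?Pf x - f x \<partial>measure_pmf M) = 0"
    using fin by simp
  then have "AE x in measure_pmf M. ?Pf x - f x = 0"
    by (subst (asm) nn_integral_0_iff_AE) auto
  with x have "?Pf x = 0" by (auto simp: AE_measure_pmf_iff)
  then have "AE y in measure_pmf (K x). f y = 0"
    by (subst (asm) nn_integral_0_iff_AE) auto
  with y show ?thesis by (auto simp: AE_measure_pmf_iff)
qed

section \<open>Foster chains: the maximum principle and convergence\<close>

primrec walk :: "('a \<Rightarrow> 'a pmf) \<Rightarrow> nat \<Rightarrow> 'a \<Rightarrow> 'a pmf" where
  "walk K 0 x = return_pmf x"
| "walk K (Suc t) x = bind_pmf (walk K t x) K"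

lemma walk_Suc_first: "walk K (Suc t) x = bind_pmf (K x) (walk K t)"
proof (induction t)
  case 0
  show ?case by (simp add: bind_return_pmf bind_return_pmf')
next
  case (Suc t)
  have "walk K (Suc (Suc t)) x = bind_pmf (walk K (Suc t) x) K"
    by (rule walk.simps(2))
  also have "\<dots> = bind_pmf (bind_pmf (K x) (walk K t)) K"
    by (simp only: Suc.IH)
  also have "\<dots> = bind_pmf (K x) (walk K (Suc t))"
    by (simp add: bind_assoc_pmf cong: bind_pmf_cong)
  finally show ?case .
qed

lemma bind_walk_stationary:
  assumes "bind_pmf M K = M" shows "bind_pmf M (walk K t) = M"
proof (induction t)
  case (Suc t)
  have "bind_pmf M (walk K (Suc t)) = bind_pmf (bind_pmf M (walk K t)) K"
    by (simp add: bind_assoc_pmf cong: bind_pmf_cong)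
  with Suc assms show ?case by (simp del: walk.simps)
qed (simp add: bind_return_pmf')

definition edges :: "('a \<Rightarrow> 'a pmf) \<Rightarrow> ('a \<times> 'a) set" where
  "edges K = {(x, y). y \<in> set_pmf (K x)}"

lemma reach_from_walk:
  "y \<in> set_pmf (walk K t x) \<Longrightarrow> (x, y) \<in> (edges K)\<^sup>*"
proof (induction t arbitrary: y)
  case (Suc t)
  then obtain z where "z \<in> set_pmf (walk K t x)" "y \<in> set_pmf (K z)" by auto
  with Suc.IH show ?case by (auto simp: edges_def intro: rtrancl_into_rtrancl)
qed simp

text \<open>Foster's setting: an atom \<open>a\<close> that every state can reach and that carries a self-loop (so the
  chain has a single aperiodic recurrent class), and a potential \<open>V\<close> whose mean falls by at least
  \<open>c\<close> in each step taken outside a finite set \<open>D\<close>.\<close>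

locale foster_chain =
  fixes K :: "'a \<Rightarrow> 'a pmf" and a :: 'a and V :: "'a \<Rightarrow> real" and D :: "'a set" and c b :: real
  assumes finite_D: "finite D"
    and reach: "\<And>x. (x, a) \<in> (edges K)\<^sup>*"
    and loop: "a \<in> set_pmf (K a)"
    and V_nonneg: "\<And>x. V x \<ge> 0"
    and b_nonneg: "b \<ge> 0"
    and c_pos: "c > 0"
    and drift: "\<And>x. (\<integral>\<^sup>+y. ennreal (V y) \<partial>measure_pmf (K x)) + ennreal c
        \<le> ennreal (V x) + ennreal b * indicator D x"
begin

text \<open>Off \<open>D\<close> the potential pays \<open>c\<close> per step, so the chain survives \<open>t\<close> steps without visiting \<open>D\<close>
  with probability at most \<open>V x / (c * t)\<close>, and \<open>w x\<close> is at most \<open>C\<close> times that.  The proof runs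
  this estimate as an induction on the inequality \<open>t * c * w \<le> C * V\<close>, without any stopping time.\<close>

lemma stopped_subharmonic_eq_0:
  fixes w :: "'a \<Rightarrow> ennreal"
  assumes bdd: "\<And>x. w x \<le> C" "C < \<infinity>"
    and on_D: "\<And>x. x \<in> D \<Longrightarrow> w x = 0"
    and off_D: "\<And>x. x \<notin> D \<Longrightarrow> w x \<le> (\<integral>\<^sup>+y. w y \<partial>measure_pmf (K x))"
  shows "w x = 0"
proof -
  \<comment> \<open>The induction step adds one more \<open>c * w\<close>, at most \<open>c * C\<close>, and the drift pays for it.\<close>
  have bound: "of_nat t * (ennreal c * w x) \<le> C * ennreal (V x)" for t x
  proof (induction t arbitrary: x)
    case (Suc t)
    show ?case
    proof (cases "x \<in> D")
      case False
      have "of_nat (Suc t) * (ennreal c * w x)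
          \<le> of_nat (Suc t) * (ennreal c * (\<integral>\<^sup>+y. w y \<partial>measure_pmf (K x)))"
        by (intro mult_left_mono off_D False) auto
      also have "\<dots> = (\<integral>\<^sup>+y. of_nat t * (ennreal c * w y) \<partial>measure_pmf (K x))
          + ennreal c * (\<integral>\<^sup>+y. w y \<partial>measure_pmf (K x))"
        by (simp add: nn_integral_cmult distrib_right add.commute)
      also have "\<dots> \<le> (\<integral>\<^sup>+y. C * ennreal (V y) \<partial>measure_pmf (K x)) + ennreal c * (\<integral>\<^sup>+y. C \<partial>measure_pmf (K x))"
        by (intro add_mono nn_integral_mono mult_left_mono Suc.IH bdd) auto
      also have "\<dots> = C * ((\<integral>\<^sup>+y. ennreal (V y) \<partial>measure_pmf (K x)) + ennreal c)"
        by (simp add: nn_integral_cmult distrib_left mult.commute)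
      also have "\<dots> \<le> C * ennreal (V x)"
        using drift[of x] False by (intro mult_left_mono) auto
      finally show ?thesis .
    qed (simp add: on_D)
  qed simp
  have "C * ennreal (V x) < \<infinity>" using bdd(2) by (simp add: ennreal_mult_less_top)
  from ennreal_multiples_bounded[OF bound this]
  show ?thesis using c_pos by auto
qed

text \<open>A maximum principle.  Let \<open>s\<close> be the maximum of \<open>h\<close> on the finite set \<open>insert a D\<close>.  The excess of
  \<open>h\<close> over \<open>s\<close> is subharmonic and vanishes on \<open>D\<close>, so it is zero and \<open>s\<close> is the global maximum.  A
  maximum of a subharmonic function spreads to all successors, hence to \<open>a\<close>, where \<open>h\<close> is zero.\<close>

lemma subharmonic_eq_0:
  fixes h :: "'a \<Rightarrow> ennreal"
  assumes bdd: "\<And>x. h x \<le> C" "C < \<infinity>"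
    and at_a: "h a = 0"
    and sub: "\<And>x. h x \<le> (\<integral>\<^sup>+y. h y \<partial>measure_pmf (K x))"
  shows "h x = 0"
proof -
  \<comment> \<open>The atom is included to make the set non-empty.\<close>
  define s where "s = Max (h ` insert a D)"
  have fin: "finite (h ` insert a D)" using finite_D by simp
  obtain x0 where x0: "h x0 = s"
    using Max_in[OF fin] unfolding s_def by fastforce
  have s_fin: "s < \<infinity>" using bdd x0 by (metis le_less_trans)
  have le_s: "h y \<le> s" for y
  proof -
    have "h y - s = 0"
    proof (rule stopped_subharmonic_eq_0[where w="\<lambda>y. h y - s" and C=C])
      fix x
      show "h x - s \<le> C" using bdd(1)[of x] diff_le_self_ennreal order_trans by blast
      show "h x - s = 0" if "x \<in> D"
        using that fin le_less_trans[OF bdd] by (simp add: s_def diff_eq_0_iff_ennreal)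
      have "h y \<le> s + (h y - s)" for y
        by (cases "s \<le> h y") (auto simp: add_diff_inverse_ennreal not_le intro!: add_increasing2)
      then have "h x \<le> (\<integral>\<^sup>+y. s + (h y - s) \<partial>measure_pmf (K x))"
        by - (rule order_trans[OF sub nn_integral_mono], simp)
      also have "\<dots> = s + (\<integral>\<^sup>+y. h y - s \<partial>measure_pmf (K x))"
        by (subst nn_integral_add) auto
      finally show "h x - s \<le> (\<integral>\<^sup>+y. h y - s \<partial>measure_pmf (K x))"
        using s_fin by (auto simp: ennreal_minus_le_iff)
    qed (use bdd in auto)
    then show ?thesis using s_fin by (simp add: diff_eq_0_iff_ennreal)
  qed
  have max_propagates: "h y = s" if "h x = s" "y \<in> set_pmf (K x)" for x y
  proof -
    have "(\<integral>\<^sup>+y. s - h y \<partial>measure_pmf (K x))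
        = (\<integral>\<^sup>+y. s \<partial>measure_pmf (K x)) - (\<integral>\<^sup>+y. h y \<partial>measure_pmf (K x))"
    proof (rule nn_integral_diff)
      have "(\<integral>\<^sup>+y. h y \<partial>measure_pmf (K x)) \<le> (\<integral>\<^sup>+y. s \<partial>measure_pmf (K x))"
        by (intro nn_integral_mono le_s)
      then show "(\<integral>\<^sup>+y. h y \<partial>measure_pmf (K x)) \<noteq> \<infinity>" using s_fin by auto
    qed (auto simp: le_s)
    also have "\<dots> = 0" using sub[of x] that(1) s_fin by (simp add: diff_eq_0_iff_ennreal)
    finally have "AE y in measure_pmf (K x). s - h y = 0"
      by (subst (asm) nn_integral_0_iff_AE) auto
    then have "s - h y = 0" using that(2) by (auto simp: AE_measure_pmf_iff)
    with le_s[of y] s_fin show "h y = s" by (simp add: diff_eq_0_iff_ennreal)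
  qed
  have "h y = s" if "(x0, y) \<in> (edges K)\<^sup>*" for y
    using that
  proof induction
    case (step y z)
    then show ?case using max_propagates[of y z] by (simp add: edges_def)
  qed (rule x0)
  with reach[of x0] at_a have "s = 0" by simp
  with le_s[of x] show ?thesis by simp
qed

lemma support_closed:
  assumes "bind_pmf M K = M" "x \<in> set_pmf M" "y \<in> set_pmf (K x)"
  shows "y \<in> set_pmf M"
proof -
  have "y \<in> set_pmf (bind_pmf M K)" using assms(2,3) by auto
  with assms(1) show ?thesis by simp
qed

lemma atom_in_support:
  assumes "bind_pmf M K = M" shows "a \<in> set_pmf M"
proof -
  obtain x where x: "x \<in> set_pmf M" using set_pmf_not_empty by fast
  have "y \<in> set_pmf M" if "(x, y) \<in> (edges K)\<^sup>*" for y
    using that by induction (auto simp: x edges_def intro: support_closed[OF assms])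
  then show ?thesis using reach by blast
qed

text \<open>Run two copies of the chain independently.  The limiting distance between the laws of the walks
  from \<open>x\<close> and from \<open>y\<close> is a bounded subharmonic function of the pair \<open>(x, y)\<close>, for which
  \<open>pair_pmf M M\<close> is stationary, and it is zero at \<open>(a, a)\<close>.  Its zeros in the support of the
  stationary law are closed under transitions; keeping the first copy at \<open>a\<close> by means of the
  self-loop, the second copy carries the zero along any path from \<open>a\<close>.\<close>

lemma merging_from_atom:
  assumes stat: "bind_pmf M K = M" and reach_x: "(a, x) \<in> (edges K)\<^sup>*"
  shows "limsup (\<lambda>t. l1_dist (walk K t a) (walk K t x)) = 0"
proof -
  \<comment> \<open>Two independent copies of the chain.\<close>
  define K2 where "K2 = (\<lambda>(x, y). pair_pmf (K x) (K y))"
  define f where "f = (\<lambda>(x, y). limsup (\<lambda>t. l1_dist (walk K t x) (walk K t y)))"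
  have f_le: "f p \<le> 2" for p
    by (auto simp: f_def split_beta intro!: limsup_le_const l1_dist_le_2)
  have stat2: "bind_pmf (pair_pmf M M) K2 = pair_pmf M M"
  proof -
    have "bind_pmf (pair_pmf M M) K2
        = bind_pmf M (\<lambda>x. bind_pmf M (\<lambda>y. bind_pmf (K x) (\<lambda>u. bind_pmf (K y) (\<lambda>v. return_pmf (u, v)))))"
      by (simp add: K2_def pair_pmf_def bind_assoc_pmf bind_return_pmf)
    also have "\<dots> = bind_pmf M (\<lambda>x. bind_pmf (K x) (\<lambda>u. bind_pmf M (\<lambda>y. bind_pmf (K y) (\<lambda>v. return_pmf (u, v)))))"
      by (subst bind_commute_pmf) simp
    also have "\<dots> = pair_pmf (bind_pmf M K) (bind_pmf M K)"
      by (simp add: pair_pmf_def bind_assoc_pmf)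
    finally show ?thesis using stat by simp
  qed
  have sub2: "f p \<le> (\<integral>\<^sup>+q. f q \<partial>measure_pmf (K2 p))" for p
  proof -
    obtain x y where p: "p = (x, y)" by (cases p)
    have mono: "l1_dist (walk K (Suc t) x) (walk K (Suc t) y)
        \<le> (\<integral>\<^sup>+q. l1_dist (walk K t (fst q)) (walk K t (snd q)) \<partial>measure_pmf (K2 p))" for t
    proof -
      have "walk K (Suc t) x = bind_pmf (map_pmf fst (K2 p)) (walk K t)"
        "walk K (Suc t) y = bind_pmf (map_pmf snd (K2 p)) (walk K t)"
        by (simp_all only: walk_Suc_first K2_def p prod.case map_fst_pair_pmf map_snd_pair_pmf)
      then show ?thesis
        using l1_dist_bind_le[of "K2 p" "\<lambda>q. walk K t (fst q)" "\<lambda>q. walk K t (snd q)"]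
        by (simp add: bind_map_pmf)
    qed
    have "f p = limsup (\<lambda>t. l1_dist (walk K (Suc t) x) (walk K (Suc t) y))"
      unfolding f_def p prod.case
      by (rule limsup_shift[symmetric, of "\<lambda>t. l1_dist (walk K t x) (walk K t y)", unfolded Suc_eq_plus1[symmetric]])
    also have "\<dots> \<le> limsup (\<lambda>t. \<integral>\<^sup>+q. l1_dist (walk K t (fst q)) (walk K t (snd q)) \<partial>measure_pmf (K2 p))"
      by (intro Limsup_mono always_eventually allI mono)
    also have "\<dots> \<le> (\<integral>\<^sup>+q. f q \<partial>measure_pmf (K2 p))"
      unfolding f_def split_beta
      by (rule limsup_nn_integral_pmf_le[where C=2]) (auto simp: l1_dist_le_2)
    finally show ?thesis .
  qed
  have a: "a \<in> set_pmf M" by (rule atom_in_support[OF stat])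
  have "x \<in> set_pmf M \<and> f (a, x) = 0"
    using reach_x
  proof induction
    case base
    then show ?case using a by (simp add: f_def Limsup_const)
  next
    case (step y z)
    then have "(a, y) \<in> set_pmf (pair_pmf M M)" "(a, z) \<in> set_pmf (K2 (a, y))" "z \<in> set_pmf M"
      using a loop support_closed[OF stat] by (auto simp: K2_def edges_def)
    moreover have "f (a, z) = 0"
      by (rule subharmonic_zeros_closed[OF stat2 f_le _ sub2, of "(a, y)"])
         (use step calculation in auto)
    ultimately show ?case by simp
  qed
  then show ?thesis by (simp add: f_def)
qed

text \<open>The limiting distance \<open>h\<close> to equilibrium is bounded and subharmonic.  At \<open>a\<close> it is at most the
  average over \<open>M\<close> of the distances between the walks from \<open>a\<close> and from \<open>x\<close>, which tend to zero.
  The maximum principle then extends \<open>h = 0\<close> from \<open>a\<close> to all starting points, transient ones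
  included.\<close>

lemma convergence_to_stationary:
  assumes stat: "bind_pmf M K = M"
    and supp: "\<And>x. x \<in> set_pmf M \<Longrightarrow> (a, x) \<in> (edges K)\<^sup>*"
  shows "(\<lambda>t. l1_dist (walk K t x) M) \<longlonglongrightarrow> 0"
proof -
  define h where "h x = limsup (\<lambda>t. l1_dist (walk K t x) M)" for x
  have "h x = 0"
  proof (rule subharmonic_eq_0[where h=h and C=2])
    show "h x \<le> 2" for x by (auto simp: h_def intro!: limsup_le_const l1_dist_le_2)
    have "l1_dist (walk K t a) M \<le> (\<integral>\<^sup>+x. l1_dist (walk K t a) (walk K t x) \<partial>measure_pmf M)" for t
      using l1_dist_bind_le[of M "\<lambda>_. walk K t a" "walk K t"]
      by (simp add: bind_walk_stationary[OF stat])
    then have "h a \<le> limsup (\<lambda>t. \<integral>\<^sup>+x. l1_dist (walk K t a) (walk K t x) \<partial>measure_pmf M)"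
      unfolding h_def by (intro Limsup_mono always_eventually allI)
    also have "\<dots> \<le> (\<integral>\<^sup>+x. limsup (\<lambda>t. l1_dist (walk K t a) (walk K t x)) \<partial>measure_pmf M)"
      by (rule limsup_nn_integral_pmf_le[where C=2]) (auto simp: l1_dist_le_2)
    also have "\<dots> = (\<integral>\<^sup>+x. 0 \<partial>measure_pmf M)"
      by (rule nn_integral_cong_AE) (auto simp: AE_measure_pmf_iff merging_from_atom[OF stat supp])
    finally show "h a = 0" by simp
    fix x
    have "h x = limsup (\<lambda>t. l1_dist (walk K (Suc t) x) M)"
      unfolding h_def
      by (rule limsup_shift[symmetric, of "\<lambda>t. l1_dist (walk K t x) M", unfolded Suc_eq_plus1[symmetric]])
    also have "\<dots> \<le> limsup (\<lambda>t. \<integral>\<^sup>+y. l1_dist (walk K t y) M \<partial>measure_pmf (K x))"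
      using l1_dist_bind_le[of "K x" "walk K _" "\<lambda>_. M"]
      by (intro Limsup_mono always_eventually allI) (simp add: walk_Suc_first del: walk.simps)
    also have "\<dots> \<le> (\<integral>\<^sup>+y. h y \<partial>measure_pmf (K x))"
      unfolding h_def by (rule limsup_nn_integral_pmf_le[where C=2]) (auto simp: l1_dist_le_2)
    finally show "h x \<le> (\<integral>\<^sup>+y. h y \<partial>measure_pmf (K x))" .
  qed auto
  then show ?thesis unfolding h_def by (rule tendsto_0_if_Limsup_eq_0_ennreal)
qed


section \<open>Foster chains: existence and uniqueness of the stationary distribution\<close>

text \<open>The drift inequality summed along the walk, written additively to stay inside \<open>ennreal\<close>.\<close>

lemma expected_potential_walk:
  "(\<integral>\<^sup>+y. ennreal (V y) \<partial>measure_pmf (walk K t x)) + ennreal (real t * c)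
     \<le> ennreal (V x) + ennreal (b * (\<Sum>s<t. measure_pmf.prob (walk K s x) D))"
proof (induction t)
  case (Suc t)
  let ?E = "\<lambda>t. \<integral>\<^sup>+y. ennreal (V y) \<partial>measure_pmf (walk K t x)"
  have "?E (Suc t) + ennreal c = (\<integral>\<^sup>+y. (\<integral>\<^sup>+z. ennreal (V z) \<partial>measure_pmf (K y)) + ennreal c \<partial>measure_pmf (walk K t x))"
    by (simp add: nn_integral_add)
  also have "\<dots> \<le> (\<integral>\<^sup>+y. ennreal (V y) + ennreal b * indicator D y \<partial>measure_pmf (walk K t x))"
    by (intro nn_integral_mono drift)
  also have "\<dots> = ?E t + ennreal (b * measure_pmf.prob (walk K t x) D)"
    using b_nonneg
    by (simp add: nn_integral_add nn_integral_cmult measure_pmf.emeasure_eq_measure ennreal_mult)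
  finally have step: "?E (Suc t) + ennreal c \<le> ?E t + ennreal (b * measure_pmf.prob (walk K t x) D)" .
  have "?E (Suc t) + ennreal (real (Suc t) * c) = (?E (Suc t) + ennreal c) + ennreal (real t * c)"
    using c_pos by (simp add: algebra_simps ennreal_plus)
  also have "\<dots> \<le> (?E t + ennreal (real t * c)) + ennreal (b * measure_pmf.prob (walk K t x) D)"
    using add_right_mono[OF step, of "ennreal (real t * c)"] by (simp add: ac_simps)
  also have "\<dots> \<le> (ennreal (V x) + ennreal (b * (\<Sum>s<t. measure_pmf.prob (walk K s x) D))) + ennreal (b * measure_pmf.prob (walk K t x) D)"
    by (intro add_right_mono Suc.IH)
  also have "\<dots> = ennreal (V x) + ennreal (b * (\<Sum>s<Suc t. measure_pmf.prob (walk K s x) D))"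
    using b_nonneg by (simp add: distrib_left add.assoc ennreal_plus sum_nonneg)
  finally show ?case .
qed simp

definition occupation :: "nat \<Rightarrow> 'a pmf" where
  "occupation T = bind_pmf (pmf_of_set {..T}) (\<lambda>t. walk K t a)"

lemma pmf_occupation: "pmf (occupation T) x = (\<Sum>t\<le>T. pmf (walk K t a) x) / real (Suc T)"
  unfolding occupation_def by (subst pmf_bind_pmf_of_set) auto

text \<open>As the potential is non-negative, the decrease by \<open>c\<close> per step must be financed by visits to
  \<open>D\<close>: the walk spends a fraction of at least about \<open>c / b\<close> of its time there.\<close>

lemma occupation_of_D: "c \<le> V a / real (Suc T) + b * (\<Sum>x\<in>D. pmf (occupation T) x)"
proof -
  let ?S = "\<Sum>s<Suc T. measure_pmf.prob (walk K s a) D"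
  have "ennreal (real (Suc T) * c) \<le> ennreal (V a) + ennreal (b * ?S)"
    using expected_potential_walk[of "Suc T" a] by (rule order_trans[rotated]) simp
  also have "\<dots> = ennreal (V a + b * ?S)"
    using b_nonneg V_nonneg by (simp add: sum_nonneg)
  finally have "real (Suc T) * c \<le> V a + b * ?S"
    using b_nonneg V_nonneg by (subst (asm) ennreal_le_iff) (auto intro!: add_nonneg_nonneg mult_nonneg_nonneg sum_nonneg)
  moreover have "?S = real (Suc T) * (\<Sum>x\<in>D. pmf (occupation T) x)"
  proof -
    have "?S = (\<Sum>t\<le>T. \<Sum>x\<in>D. pmf (walk K t a) x)"
      by (simp only: measure_measure_pmf_finite[OF finite_D] lessThan_Suc_atMost)
    also have "\<dots> = (\<Sum>x\<in>D. \<Sum>t\<le>T. pmf (walk K t a) x)" by (rule sum.swap)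
    finally show ?thesis by (simp add: pmf_occupation sum_divide_distrib[symmetric])
  qed
  ultimately have "real (Suc T) * c \<le> V a + b * (real (Suc T) * (\<Sum>x\<in>D. pmf (occupation T) x))"
    by (simp only:)
  then have "c \<le> (V a + b * (real (Suc T) * (\<Sum>x\<in>D. pmf (occupation T) x))) / real (Suc T)"
    by (simp only: pos_le_divide_eq of_nat_0_less_iff zero_less_Suc mult.commute)
  then show ?thesis by (simp add: add_divide_distrib)
qed

text \<open>Shifting the time average by one step exchanges only its two end terms.\<close>

lemma occupation_almost_invariant:
  "pmf (bind_pmf (occupation T) K) x \<le> pmf (occupation T) x + 1 / real (Suc T)"
proof -
  have "bind_pmf (occupation T) K = bind_pmf (pmf_of_set {..T}) (\<lambda>t. walk K (Suc t) a)"
    by (simp add: occupation_def bind_assoc_pmf)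
  then have "pmf (bind_pmf (occupation T) K) x = (\<Sum>t\<le>T. pmf (walk K (Suc t) a) x) / real (Suc T)"
    by (simp only:) (subst pmf_bind_pmf_of_set, auto)
  also have "(\<Sum>t\<le>T. pmf (walk K (Suc t) a) x)
      = (\<Sum>t\<le>T. pmf (walk K t a) x) + pmf (walk K (Suc T) a) x - pmf (walk K 0 a) x"
    by (induction T) simp_all
  also have "\<dots> \<le> (\<Sum>t\<le>T. pmf (walk K t a) x) + 1"
    using pmf_le_1[of "walk K (Suc T) a" x] pmf_nonneg[of "walk K 0 a" x] by linarith
  finally show ?thesis by (simp add: pmf_occupation add_divide_distrib divide_right_mono)
qed

text \<open>A pointwise limit \<open>\<rho>\<close> of occupation distributions, taken along a subsequence, may have lost mass,
  but not all of it: the finite set \<open>D\<close> retains a positive amount.  By Fatou's lemma one step of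
  the chain maps \<open>\<rho>\<close> to a measure below \<open>\<rho>\<close>, and since a step preserves mass the normalised \<open>\<rho>\<close> is
  stationary.\<close>

lemma exists_stationary:
  obtains M where "bind_pmf M K = M" "\<And>x. x \<in> set_pmf M \<Longrightarrow> (a, x) \<in> (edges K)\<^sup>*"
proof -
  define S where "S = (\<Union>t. set_pmf (walk K t a))"
  have "countable S" unfolding S_def by auto
  then obtain k :: "nat \<Rightarrow> nat" where k: "strict_mono k"
    and k_conv: "\<And>x. x \<in> S \<Longrightarrow> \<exists>l. (\<lambda>i. pmf (occupation (k i)) x) \<longlonglongrightarrow> l"
    by (rule function_convergent_subsequence[where f="\<lambda>T x. pmf (occupation T) x" and M=1])
       (auto simp: pmf_le_1)
  have off_S: "pmf (occupation T) x = 0" if "x \<notin> S" for T x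
    using that by (auto simp: pmf_occupation S_def set_pmf_iff)
  define \<rho> where "\<rho> x = lim (\<lambda>i. pmf (occupation (k i)) x)" for x
  have \<rho>: "(\<lambda>i. pmf (occupation (k i)) x) \<longlonglongrightarrow> \<rho> x" for x
  proof (cases "x \<in> S")
    case True
    then show ?thesis using k_conv unfolding \<rho>_def by (simp add: convergent_def convergent_LIMSEQ_iff[symmetric])
  next
    case False
    then show ?thesis unfolding \<rho>_def by (simp add: off_S)
  qed
  have \<rho>_nonneg: "\<rho> x \<ge> 0" for x
    using \<rho> by (rule LIMSEQ_le_const) auto
  have \<rho>_off_S: "\<rho> x = 0" if "x \<notin> S" for x
    using \<rho>[of x] that by (simp add: off_S LIMSEQ_const_iff)
  have inv_k: "(\<lambda>i. r / real (Suc (k i))) \<longlonglongrightarrow> 0" for r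
  proof -
    have "(\<lambda>T. r / real (Suc T)) \<longlonglongrightarrow> 0" by real_asymp
    from LIMSEQ_subseq_LIMSEQ[OF this k] show ?thesis by (simp add: o_def)
  qed
  have "(\<lambda>i. V a / real (Suc (k i)) + b * (\<Sum>x\<in>D. pmf (occupation (k i)) x))
      \<longlonglongrightarrow> 0 + b * (\<Sum>x\<in>D. \<rho> x)"
    by (intro tendsto_intros inv_k \<rho>)
  then have "c \<le> 0 + b * (\<Sum>x\<in>D. \<rho> x)"
    by (rule LIMSEQ_le_const) (use occupation_of_D in auto)
  with c_pos have "(\<Sum>x\<in>D. \<rho> x) \<noteq> 0" by auto
  then obtain x0 where x0: "\<rho> x0 \<noteq> 0" by (meson sum.neutral)
  \<comment> \<open>The mass that survives in the limit; the state \<open>x0\<close> shows that it is positive.\<close>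
  define Z where "Z = (\<integral>\<^sup>+x. ennreal (\<rho> x) \<partial>count_space UNIV)"
  \<comment> \<open>Fatou gives only an inequality, which is what the comparison of distributions below needs.\<close>
  have fatou: "(\<integral>\<^sup>+x. ennreal (\<rho> x) * ennreal (pmf (K x) y) \<partial>count_space UNIV) \<le> ennreal (\<rho> y)" for y
  proof -
    have lims: "(\<lambda>i. ennreal (pmf (occupation (k i)) x) * ennreal (pmf (K x) y))
        \<longlonglongrightarrow> ennreal (\<rho> x) * ennreal (pmf (K x) y)" for x
      using \<rho>[of x] by (simp add: ennreal_mult[symmetric] \<rho>_nonneg) (intro tendsto_intros)
    have "(\<integral>\<^sup>+x. ennreal (\<rho> x) * ennreal (pmf (K x) y) \<partial>count_space UNIV)
        = (\<integral>\<^sup>+x. liminf (\<lambda>i. ennreal (pmf (occupation (k i)) x) * ennreal (pmf (K x) y)) \<partial>count_space UNIV)"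
      by (simp add: lim_imp_Liminf[OF _ lims])
    also have "\<dots> \<le> liminf (\<lambda>i. \<integral>\<^sup>+x. ennreal (pmf (occupation (k i)) x) * ennreal (pmf (K x) y) \<partial>count_space UNIV)"
      by (rule nn_integral_liminf) auto
    also have "\<dots> = liminf (\<lambda>i. ennreal (pmf (bind_pmf (occupation (k i)) K) y))"
      by (simp add: ennreal_pmf_bind nn_integral_measure_pmf)
    also have "\<dots> \<le> liminf (\<lambda>i. ennreal (pmf (occupation (k i)) y + 1 / real (Suc (k i))))"
      by (intro Liminf_mono always_eventually allI ennreal_leI occupation_almost_invariant)
    also have "\<dots> = ennreal (\<rho> y + 0)"
      by (intro lim_imp_Liminf tendsto_ennrealI tendsto_add \<rho> inv_k) simp
    finally show ?thesis by simp
  qed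
  have "Z = (\<integral>\<^sup>+x. liminf (\<lambda>i. ennreal (pmf (occupation (k i)) x)) \<partial>count_space UNIV)"
    unfolding Z_def by (simp add: lim_imp_Liminf[OF _ tendsto_ennrealI[OF \<rho>]])
  also have "\<dots> \<le> liminf (\<lambda>i. \<integral>\<^sup>+x. ennreal (pmf (occupation (k i)) x) \<partial>count_space UNIV)"
    by (rule nn_integral_liminf) auto
  also have "\<dots> = 1" by (simp add: nn_integral_pmf Liminf_const)
  finally have "Z \<le> 1" .
  moreover have "Z \<noteq> 0"
    using x0 \<rho>_nonneg[of x0] unfolding Z_def
    by (subst nn_integral_0_iff_AE) (auto simp: AE_count_space ennreal_eq_0_iff intro!: exI[of _ x0])
  ultimately obtain z where z: "Z = ennreal z" "z > 0"
    by (cases Z) (auto simp: ennreal_eq_0_iff not_le top_unique)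
  define M where "M = embed_pmf (\<lambda>x. \<rho> x / z)"
  have pmf_M: "pmf M x = \<rho> x / z" for x
    unfolding M_def
  proof (rule pmf_embed_pmf)
    show "0 \<le> \<rho> x / z" for x using \<rho>_nonneg z by simp
    have "(\<integral>\<^sup>+x. ennreal (\<rho> x / z) \<partial>count_space UNIV) = Z / ennreal z"
      unfolding Z_def using z(2) \<rho>_nonneg
      by (subst nn_integral_divide[symmetric]) (auto simp: divide_ennreal)
    then show "(\<integral>\<^sup>+x. ennreal (\<rho> x / z) \<partial>count_space UNIV) = 1"
      using z by (simp add: divide_ennreal)
  qed
  have "bind_pmf M K = M"
  proof (rule pmf_eqI_le)
    fix y
    have "ennreal (pmf (bind_pmf M K) y)
        = (\<integral>\<^sup>+x. ennreal (\<rho> x) * ennreal (pmf (K x) y) / ennreal z \<partial>count_space UNIV)"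
      using z \<rho>_nonneg
      by (simp add: ennreal_pmf_bind nn_integral_measure_pmf pmf_M divide_ennreal ennreal_mult[symmetric] flip: times_divide_eq_left)
    also have "\<dots> = (\<integral>\<^sup>+x. ennreal (\<rho> x) * ennreal (pmf (K x) y) \<partial>count_space UNIV) / ennreal z"
      by (rule nn_integral_divide) auto
    also have "\<dots> \<le> ennreal (\<rho> y) / ennreal z"
      by (intro divide_right_mono_ennreal fatou)
    also have "\<dots> = ennreal (pmf M y)"
      using z \<rho>_nonneg by (simp add: pmf_M divide_ennreal)
    finally show "pmf (bind_pmf M K) y \<le> pmf M y" by simp
  qed
  moreover have "(a, x) \<in> (edges K)\<^sup>*" if "x \<in> set_pmf M" for x
  proof -
    have "x \<in> S" using that \<rho>_off_S by (auto simp: set_pmf_iff pmf_M)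
    then show ?thesis by (auto simp: S_def intro: reach_from_walk)
  qed
  ultimately show ?thesis by (rule that)
qed

theorem unique_stationary_and_convergence:
  obtains M where "bind_pmf M K = M"
    and "\<And>M'. bind_pmf M' K = M' \<Longrightarrow> M' = M"
    and "\<And>x. (\<lambda>t. l1_dist (walk K t x) M) \<longlonglongrightarrow> 0"
proof -
  obtain M where M: "bind_pmf M K = M" "\<And>x. x \<in> set_pmf M \<Longrightarrow> (a, x) \<in> (edges K)\<^sup>*"
    using exists_stationary by blast
  note conv = convergence_to_stationary[OF M]
  have "M' = M" if "bind_pmf M' K = M'" for M'
  proof (rule l1_dist_eq_0D)
    have "l1_dist M' M \<le> (\<integral>\<^sup>+x. l1_dist (walk K t x) M \<partial>measure_pmf M')" for t
      using l1_dist_bind_le[of M' "walk K t" "\<lambda>_. M"] by (simp add: bind_walk_stationary[OF that])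
    then have "limsup (\<lambda>t::nat. l1_dist M' M) \<le> limsup (\<lambda>t. \<integral>\<^sup>+x. l1_dist (walk K t x) M \<partial>measure_pmf M')"
      by (intro Limsup_mono always_eventually allI)
    also have "\<dots> \<le> (\<integral>\<^sup>+x. limsup (\<lambda>t. l1_dist (walk K t x) M) \<partial>measure_pmf M')"
      by (rule limsup_nn_integral_pmf_le[where C=2]) (auto simp: l1_dist_le_2)
    also have "\<dots> = 0" by (simp add: lim_imp_Limsup[OF _ conv])
    finally show "l1_dist M' M = 0" by (simp add: Limsup_const)
  qed
  with M(1) conv that show ?thesis by blast
qed

end

section \<open>Sums over countable sets\<close>

text \<open>The sums over \<open>configs n\<close> that define powers, equilibrium and distance are turned into
  counting-measure integrals, to which the theory of distributions applies.\<close>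

lemma infsum_eq_nn_integral:
  fixes f :: "'a \<Rightarrow> real"
  assumes nonneg: "\<And>x. f x \<ge> 0" and off: "\<And>x. x \<notin> S \<Longrightarrow> f x = 0"
    and fin: "(\<integral>\<^sup>+x. f x \<partial>count_space UNIV) < \<infinity>"
  shows "(\<Sum>\<^sub>\<infinity>x\<in>S. f x) = enn2real (\<integral>\<^sup>+x. f x \<partial>count_space UNIV)"
proof -
  have "(\<Sum>\<^sub>\<infinity>x\<in>S. f x) = (\<Sum>\<^sub>\<infinity>x\<in>UNIV. f x)"
    by (rule infsum_cong_neutral) (auto simp: off)
  also have "\<dots> = infsetsum f UNIV"
    using fin nonneg
    by (intro infsetsum_infsum[symmetric]) (auto simp: abs_summable_on_def integrable_iff_bounded)
  also have "\<dots> = enn2real (\<integral>\<^sup>+x. f x \<partial>count_space UNIV)"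
    using fin nonneg by (intro infsetsum_conv_nn_integral) auto
  finally show ?thesis .
qed

lemma infsum_pmf_bind:
  assumes "set_pmf p \<subseteq> S"
  shows "(\<Sum>\<^sub>\<infinity>x\<in>S. pmf p x * pmf (f x) y) = pmf (bind_pmf p f) y"
proof -
  have eq: "(\<integral>\<^sup>+x. ennreal (pmf p x * pmf (f x) y) \<partial>count_space UNIV) = ennreal (pmf (bind_pmf p f) y)"
    by (simp add: ennreal_pmf_bind nn_integral_measure_pmf ennreal_mult)
  show ?thesis
    using assms by (subst infsum_eq_nn_integral) (auto simp: eq set_pmf_iff)
qed

lemma infsum_l1_dist:
  assumes "set_pmf p \<subseteq> S" "set_pmf q \<subseteq> S"
  shows "(\<Sum>\<^sub>\<infinity>x\<in>S. \<bar>pmf p x - pmf q x\<bar>) = enn2real (l1_dist p q)"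
  unfolding l1_dist_def
proof (rule infsum_eq_nn_integral)
  show "\<bar>pmf p x - pmf q x\<bar> = 0" if "x \<notin> S" for x
  proof -
    have "x \<notin> set_pmf p" "x \<notin> set_pmf q" using that assms by auto
    then show ?thesis by (simp add: set_pmf_iff)
  qed
  show "(\<integral>\<^sup>+x. ennreal \<bar>pmf p x - pmf q x\<bar> \<partial>count_space UNIV) < \<infinity>"
    using l1_dist_le_2[of p q] unfolding l1_dist_def by (rule le_less_trans) simp
qed simp

lemma nn_integral_nat_le_infsum:
  fixes f :: "nat \<Rightarrow> ennreal"
  shows "(\<integral>\<^sup>+x. f x * indicator A x \<partial>count_space UNIV) \<le> (\<Sum>\<^sub>\<infinity>x\<in>A. f x)"
proof -
  have "(\<Sum>x<N. f x * indicator A x) \<le> (\<Sum>\<^sub>\<infinity>x\<in>A. f x)" for N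
  proof -
    have "(\<Sum>x<N. f x * indicator A x) = sum f ({..<N} \<inter> A)"
      by (simp add: indicator_def sum.If_cases if_distrib cong: if_cong)
    also have "\<dots> \<le> (\<Sum>\<^sub>\<infinity>x\<in>A. f x)"
      by (subst nonneg_infsum_complete) (auto intro!: SUP_upper)
    finally show ?thesis .
  qed
  then show ?thesis
    by (simp add: nn_integral_count_space_nat suminf_le_const)
qed

section \<open>The transition kernel of the juggler's exclusion process\<close>

definition survivors :: "nat set \<Rightarrow> nat set" where
  "survivors A = shift_down (remove_min A)"

lemma inj_on_pred: "0 \<notin> A \<Longrightarrow> inj_on (\<lambda>a. a - Suc 0) A"
  by (auto simp: inj_on_def) (metis Suc_pred gr0I)

lemma shift_down_configs: "0 \<notin> A \<Longrightarrow> A \<in> configs m \<Longrightarrow> shift_down A \<in> configs m"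
  by (auto simp: configs_def shift_down_def card_image inj_on_pred)

lemma remove_min_zero: "finite A \<Longrightarrow> 0 \<in> A \<Longrightarrow> remove_min A = A - {0}"
  using Min_eqI[of A 0] by (simp add: remove_min_def)

lemma survivors_zero: "finite A \<Longrightarrow> 0 \<in> A \<Longrightarrow> survivors A = (\<lambda>a. a - 1) ` (A - {0})"
  by (simp add: survivors_def remove_min_zero shift_down_def)

lemma survivors_configs: "A \<in> configs n \<Longrightarrow> 0 \<in> A \<Longrightarrow> survivors A \<in> configs (n - 1)"
  unfolding survivors_def
  by (intro shift_down_configs) (auto simp: configs_def remove_min_zero)

locale jep =
  fixes n :: nat and \<nu> :: "nat set \<Rightarrow> nat pmf"
  assumes n_pos: "n \<ge> 1"
    and no_mass: "\<And>B. B \<in> configs (n - 1) \<Longrightarrow> (\<Sum>y\<in>B. pmf (\<nu> B) y) = 0"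
    and unif_int: "uniformly_integrable_family (n - 1) \<nu>"
    and least_pos: "\<And>B. B \<in> configs (n - 1) \<Longrightarrow> pmf (\<nu> B) (LEAST y. y \<notin> B) > 0"
begin

text \<open>The transition matrix as a kernel on all sets of naturals.  Sets that are not configurations are
  sent to the ground state, so that reachability and drift hold without restriction to
  configurations.\<close>

definition kernel :: "nat set \<Rightarrow> nat set pmf" where
  "kernel A =
     (if A \<notin> configs n then return_pmf {..<n}
      else if 0 \<notin> A then return_pmf (shift_down A)
      else map_pmf (\<lambda>y. insert y (survivors A)) (\<nu> (survivors A)))"

lemma ground_config: "{..<n} \<in> configs n" by (simp add: configs_def)

lemma config_nonempty: "A \<in> configs n \<Longrightarrow> finite A \<and> A \<noteq> {}"
  using n_pos by (auto simp: configs_def)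

lemma throw_lands_free: "B \<in> configs (n - 1) \<Longrightarrow> y \<in> set_pmf (\<nu> B) \<Longrightarrow> y \<notin> B"
  using no_mass[of B] by (auto simp: set_pmf_iff configs_def sum_nonneg_eq_0_iff)

lemma insert_free_config: "B \<in> configs (n - 1) \<Longrightarrow> y \<notin> B \<Longrightarrow> insert y B \<in> configs n"
  using n_pos by (auto simp: configs_def)

lemma set_kernel: "set_pmf (kernel A) \<subseteq> configs n"
  using insert_free_config[OF survivors_configs throw_lands_free[OF survivors_configs]]
  by (auto simp: kernel_def ground_config shift_down_configs)

text \<open>Inserting a free height determines that height, so the law of the new configuration has the
  same weights as \<open>\<nu>\<close>; insertion of an occupied height has probability zero.\<close>

lemma pmf_kernel:
  assumes A: "A \<in> configs n" shows "pmf (kernel A) B = jep_matrix \<nu> A B"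
proof (cases "0 \<in> A")
  case False
  then show ?thesis using A by (auto simp: kernel_def jep_matrix_def Let_def)
next
  case True
  let ?C = "survivors A"
  have C: "?C \<in> configs (n - 1)" by (rule survivors_configs[OF A True])
  have pmf: "pmf (kernel A) B = measure (\<nu> ?C) ((\<lambda>y. insert y ?C) -` {B})"
    using A True by (simp add: kernel_def pmf_map)
  show ?thesis
  proof (cases "\<exists>y. y \<notin> ?C \<and> B = ?C \<union> {y}")
    case True': True
    then obtain y where y: "y \<notin> ?C" "B = ?C \<union> {y}" by blast
    then have "(THE y. y \<notin> ?C \<and> B = ?C \<union> {y}) = y" by (intro the_equality) auto
    moreover have "(\<lambda>y. insert y ?C) -` {B} = {y}"
      using y by (auto simp: set_eq_iff) metis
    ultimately show ?thesis
      using True True' by (simp add: jep_matrix_def Let_def pmf survivors_def[symmetric] measure_pmf_single)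
  next
    case False
    then have "set_pmf (\<nu> ?C) \<inter> (\<lambda>y. insert y ?C) -` {B} = {}"
      using throw_lands_free[OF C] by auto
    then have "pmf (kernel A) B = 0"
      by (simp add: pmf measure_pmf_zero_iff)
    with False True show ?thesis
      unfolding jep_matrix_def Let_def survivors_def[symmetric] by auto
  qed
qed

lemma set_walk: "A \<in> configs n \<Longrightarrow> set_pmf (walk kernel t A) \<subseteq> configs n"
  using set_kernel by (cases t) auto

lemma infsum_jep_matrix:
  assumes "set_pmf p \<subseteq> configs n"
  shows "(\<Sum>\<^sub>\<infinity>C\<in>configs n. pmf p C * jep_matrix \<nu> C B) = pmf (bind_pmf p kernel) B"
  by (subst infsum_pmf_bind[OF assms, symmetric]) (simp add: pmf_kernel cong: infsum_cong)

lemma jep_power_eq_walk: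
  assumes "A \<in> configs n" shows "jep_power n \<nu> t A B = pmf (walk kernel t A) B"
proof (induction t arbitrary: B)
  case (Suc t)
  then show ?case by (simp add: infsum_jep_matrix[OF set_walk[OF assms]])
qed (simp add: indicator_def)

lemma equilibrium_iff: "equilibrium n \<nu> \<pi> \<longleftrightarrow> bind_pmf \<pi> kernel = \<pi>"
proof
  assume eq: "equilibrium n \<nu> \<pi>"
  then have supp: "set_pmf \<pi> \<subseteq> configs n" by (simp add: equilibrium_def)
  show "bind_pmf \<pi> kernel = \<pi>"
  proof (rule pmf_eqI)
    fix B
    show "pmf (bind_pmf \<pi> kernel) B = pmf \<pi> B"
    proof (cases "B \<in> configs n")
      case True
      then show ?thesis using eq by (simp add: equilibrium_def infsum_jep_matrix[OF supp])
    next
      case False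
      then have "B \<notin> set_pmf (bind_pmf \<pi> kernel)" "B \<notin> set_pmf \<pi>"
        using supp set_kernel by auto
      then show ?thesis by (simp only: set_pmf_iff not_not)
    qed
  qed
next
  assume eq: "bind_pmf \<pi> kernel = \<pi>"
  have "set_pmf (bind_pmf \<pi> kernel) \<subseteq> configs n" using set_kernel by auto
  then have "set_pmf \<pi> \<subseteq> configs n" by (simp only: eq)
  then show "equilibrium n \<nu> \<pi>" by (simp add: equilibrium_def infsum_jep_matrix eq)
qed

lemma least_throw_possible:
  assumes "A \<in> configs n" "0 \<in> A"
  shows "insert (LEAST y. y \<notin> survivors A) (survivors A) \<in> set_pmf (kernel A)"
  using assms least_pos[OF survivors_configs[OF assms]] by (auto simp: kernel_def set_pmf_iff)

section \<open>Reachability of the ground state\<close>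

text \<open>All heights below the least free one are occupied, which bounds it by the number of particles,
  with equality only for a configuration without gaps.\<close>

lemma least_free:
  assumes "B \<in> configs m" defines "y \<equiv> LEAST y. y \<notin> B"
  shows "y \<notin> B" "y \<le> m" "y = m \<Longrightarrow> B = {..<m}"
proof -
  have fin: "finite B" and card: "card B = m" using assms(1) by (auto simp: configs_def)
  show "y \<notin> B" unfolding y_def using ex_new_if_finite[OF infinite_UNIV_nat fin] by (rule LeastI_ex)
  have sub: "{..<y} \<subseteq> B" unfolding y_def using not_less_Least by auto
  from card_mono[OF fin sub] card show "y \<le> m" by simp
  assume "y = m"
  with card_subset_eq[OF fin sub] card show "B = {..<m}" by simp
qed

lemma ground_self_loop: "{..<n} \<in> set_pmf (kernel {..<n})"
proof -
  have zero: "0 \<in> {..<n}" using n_pos by simp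
  have C: "survivors {..<n} = {..<n - 1}"
  proof
    show "{..<n - 1} \<subseteq> survivors {..<n}"
    proof
      fix x assume "x \<in> {..<n - 1}"
      then show "x \<in> survivors {..<n}"
        by (subst survivors_zero[OF _ zero]) (auto intro!: image_eqI[of _ _ "Suc x"])
    qed
  qed (auto simp: survivors_zero[OF _ zero])
  have "(LEAST y. y \<notin> {..<n - 1}) = n - 1" by (rule Least_equality) auto
  then have "insert (LEAST y. y \<notin> survivors {..<n}) (survivors {..<n}) = {..<n}"
    using n_pos by (auto simp: C)
  then show ?thesis using least_throw_possible[OF ground_config zero] by simp
qed

text \<open>While the chain is not in the ground state, a step that throws to the least free height (if it
  throws at all) strictly decreases the sum of the heights.  In a throw the \<open>n - 1\<close> surviving
  particles lose \<open>n - 1\<close> in total, and the thrown one lands at \<open>n - 1\<close> or below; it lands exactly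
  at \<open>n - 1\<close> only if the survivors fill \<open>{..<n - 1}\<close>, which happens only in the ground state.\<close>

lemma reach_ground: "(A, {..<n}) \<in> (edges kernel)\<^sup>*"
proof (cases "A \<in> configs n")
  case False
  then show ?thesis by (intro r_into_rtrancl) (simp add: edges_def kernel_def)
next
  case True
  then show ?thesis
  proof (induction "\<Sum>A" arbitrary: A rule: less_induct)
    case less
    note A = \<open>A \<in> configs n\<close>
    have fin: "finite A" and ne: "A \<noteq> {}" and card: "card A = n"
      using config_nonempty[OF A] A by (auto simp: configs_def)
    have go: "(A, {..<n}) \<in> (edges kernel)\<^sup>*" if B: "B \<in> set_pmf (kernel A)" "\<Sum>B < \<Sum>A" for B
    proof -
      have "B \<in> configs n" using B(1) set_kernel by blast
      from less.hyps[OF B(2) this] B(1) show ?thesis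
        by (auto simp: edges_def intro: converse_rtrancl_into_rtrancl)
    qed
    show ?case
    proof (cases "0 \<in> A")
      case False
      have "\<Sum>(shift_down A) = (\<Sum>a\<in>A. a - 1)"
        by (simp add: shift_down_def sum.reindex inj_on_pred False)
      also have "\<dots> < (\<Sum>a\<in>A. a)"
      proof (rule sum_strict_mono[OF fin ne])
        fix a assume "a \<in> A"
        with False have "a \<noteq> 0" by metis
        then show "a - 1 < a" by simp
      qed
      finally show ?thesis
        using A False by (intro go[of "shift_down A"]) (auto simp: kernel_def)
    next
      case True
      define C where "C = survivors A"
      have C: "C \<in> configs (n - 1)" unfolding C_def by (rule survivors_configs[OF A True])
      define y where "y = (LEAST y. y \<notin> C)"
      note y = least_free[OF C, folded y_def]
      have sum_A: "\<Sum>A = \<Sum>C + (n - 1)"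
      proof -
        have "\<Sum>A = (\<Sum>a\<in>A - {0}. a)" using fin True by (simp add: sum.remove[of A 0])
        also have "\<dots> = (\<Sum>a\<in>A - {0}. (a - 1) + 1)" by (rule sum.cong) auto
        also have "\<dots> = (\<Sum>a\<in>A - {0}. a - 1) + card (A - {0})" by (simp only: sum.distrib sum_constant mult_1_right of_nat_id)
        also have "(\<Sum>a\<in>A - {0}. a - 1) = \<Sum>C"
          by (simp add: C_def survivors_zero[OF fin True] sum.reindex inj_on_pred)
        also have "card (A - {0}) = n - 1" using fin True card by simp
        finally show ?thesis .
      qed
      show ?thesis
      proof (cases "y = n - 1")
        case full: True
        have "Suc ` C = (\<lambda>a. a) ` (A - {0})"
          unfolding C_def survivors_zero[OF fin True] image_image by (rule image_cong) auto
        then have "A = insert 0 (Suc ` C)" using True by auto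
        also have "\<dots> = insert 0 (Suc ` {..<n - 1})" using y(3)[OF full] by simp
        also have "\<dots> = {..<n}"
          using n_pos by (metis Suc_pred' lessThan_Suc_eq_insert_0 less_le_trans zero_less_one)
        finally show ?thesis by simp
      next
        case False
        have "\<Sum>(insert y C) = y + \<Sum>C" using C y(1) by (simp add: configs_def)
        with False y(2) sum_A have "\<Sum>(insert y C) < \<Sum>A" by simp
        then show ?thesis
          using least_throw_possible[OF A True] by (intro go) (auto simp: C_def y_def)
      qed
    qed
  qed
qed

section \<open>Drift of the maximal height\<close>

text \<open>The value \<open>n\<close> away from the configurations exceeds the ground state's height \<open>n - 1\<close> by one, so
  the drift inequality also holds there.\<close>

definition height :: "nat set \<Rightarrow> real" where
  "height A = (if A \<in> configs n then real (Max A) else real n)"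

lemma exists_tail_bound:
  obtains L :: nat where "\<And>B. B \<in> configs (n - 1) \<Longrightarrow>
    (\<integral>\<^sup>+y. of_nat y * indicator {L<..} y \<partial>measure_pmf (\<nu> B)) \<le> ennreal (1/2)"
proof -
  let ?T = "\<lambda>K B. \<Sum>\<^sub>\<infinity>x\<in>{K<..}. of_nat x * ennreal (pmf (\<nu> B) x)"
  have "eventually (\<lambda>K. (SUP B\<in>configs (n - 1). ?T K B) < ennreal (1/2)) sequentially"
    using unif_int unfolding uniformly_integrable_family_def 
    by (rule order_tendstoD(2)) (subst ennreal_less_zero_iff, simp)
  then obtain L where L: "(SUP B\<in>configs (n - 1). ?T L B) < ennreal (1/2)"
    by (auto simp: eventually_sequentially)
  have "(\<integral>\<^sup>+y. of_nat y * indicator {L<..} y \<partial>measure_pmf (\<nu> B)) \<le> ennreal (1/2)"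
    if B: "B \<in> configs (n - 1)" for B
  proof -
    have "(\<integral>\<^sup>+y. of_nat y * indicator {L<..} y \<partial>measure_pmf (\<nu> B))
        = (\<integral>\<^sup>+x. (of_nat x * ennreal (pmf (\<nu> B) x)) * indicator {L<..} x \<partial>count_space UNIV)"
      by (simp add: nn_integral_measure_pmf ac_simps)
    also have "\<dots> \<le> ?T L B" by (rule nn_integral_nat_le_infsum)
    also have "\<dots> \<le> (SUP B\<in>configs (n - 1). ?T L B)" by (rule SUP_upper[OF B])
    finally show ?thesis using L by simp
  qed
  then show ?thesis by (rule that)
qed

text \<open>The new maximum is at most the larger of \<open>l\<close> and the landing height \<open>y\<close>, and \<open>y\<close> can exceed \<open>l\<close>
  only if it exceeds \<open>L\<close>.  So the expected overshoot is at most the tail mean beyond \<open>L\<close>, which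
  takes back at most half of the unit by which the other particles descend.\<close>

lemma height_after_step:
  assumes tail: "\<And>B. B \<in> configs (n - 1) \<Longrightarrow>
      (\<integral>\<^sup>+y. of_nat y * indicator {L<..} y \<partial>measure_pmf (\<nu> B)) \<le> ennreal (1/2)"
    and A: "A \<in> configs n" "Max A \<le> Suc l" and L: "L \<le> l"
  shows "(\<integral>\<^sup>+B. height B \<partial>measure_pmf (kernel A)) + ennreal (1/2) \<le> of_nat (Suc l)"
proof -
  have fin: "finite A" "A \<noteq> {}" using config_nonempty[OF A(1)] by auto
  have le: "a - 1 \<le> l" if "a \<in> A" for a
    using Max_ge[OF fin(1) that] A(2) by simp
  have half: "of_nat l + ennreal (1/2) + ennreal (1/2) = of_nat (Suc l)"
  proof -
    have "ennreal (1/2) + ennreal (1/2) = 1"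
      by (subst ennreal_plus[symmetric]) auto
    then show ?thesis by (metis add.assoc add.commute of_nat_Suc)
  qed
  have "(\<integral>\<^sup>+B. height B \<partial>measure_pmf (kernel A)) \<le> of_nat l + ennreal (1/2)"
  proof (cases "0 \<in> A")
    case False
    have conf: "shift_down A \<in> configs n" using shift_down_configs A(1) False by blast
    then have "height (shift_down A) \<le> real l"
      using config_nonempty[OF conf] le by (auto simp: height_def shift_down_def)
    then have "ennreal (height (shift_down A)) \<le> of_nat l"
      by (simp add: ennreal_of_nat_eq_real_of_nat ennreal_leI)
    then show ?thesis
      using A(1) False by (simp add: kernel_def add_increasing2)
  next
    case True
    let ?C = "survivors A"
    have C: "?C \<in> configs (n - 1)" by (rule survivors_configs[OF A(1) True])
    have C_le: "x \<le> l" if "x \<in> ?C" for x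
      using that le survivors_zero[OF fin(1) True] by auto
    have "(\<integral>\<^sup>+B. height B \<partial>measure_pmf (kernel A))
        = (\<integral>\<^sup>+y. height (insert y ?C) \<partial>measure_pmf (\<nu> ?C))"
      using A(1) True by (simp add: kernel_def)
    also have "\<dots> \<le> (\<integral>\<^sup>+y. of_nat l + of_nat y * indicator {L<..} y \<partial>measure_pmf (\<nu> ?C))"
    proof (intro nn_integral_mono_AE, unfold AE_measure_pmf_iff, intro ballI)
      fix y assume "y \<in> set_pmf (\<nu> ?C)"
      then have conf: "insert y ?C \<in> configs n"
        using insert_free_config[OF C] throw_lands_free[OF C] by blast
      have "Max (insert y ?C) \<le> l + y * indicator {L<..} y"
        using config_nonempty[OF conf] C_le L by (subst Max_le_iff) (auto simp: indicator_def intro: trans_le_add1)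
      then have "height (insert y ?C) \<le> real (l + y * indicator {L<..} y)"
        using conf by (simp only: height_def if_True of_nat_le_iff)
      then have "ennreal (height (insert y ?C)) \<le> of_nat (l + y * indicator {L<..} y)"
        by (simp only: ennreal_of_nat_eq_real_of_nat ennreal_leI)
      then show "ennreal (height (insert y ?C)) \<le> of_nat l + of_nat y * indicator {L<..} y"
        by (simp add: indicator_def split: if_splits)
    qed
    also have "\<dots> = of_nat l + (\<integral>\<^sup>+y. of_nat y * indicator {L<..} y \<partial>measure_pmf (\<nu> ?C))"
      by (simp add: nn_integral_add)
    also have "\<dots> \<le> of_nat l + ennreal (1/2)"
      by (intro add_left_mono tail C)
    finally show ?thesis .
  qed
  then show ?thesis unfolding half[symmetric] by (rule add_right_mono)
qed

text \<open>For \<open>Max A > L\<close> the height bound is used with \<open>l = Max A - 1\<close> and yields the drift; for the finitely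
  many configurations in \<open>{..L}\<close> it is used with \<open>l = L\<close> and bounds the expected height.\<close>

lemma exists_foster_chain:
  obtains D b where "foster_chain kernel {..<n} height D (1/2) b"
proof -
  obtain L where tail: "\<And>B. B \<in> configs (n - 1) \<Longrightarrow>
    (\<integral>\<^sup>+y. of_nat y * indicator {L<..} y \<partial>measure_pmf (\<nu> B)) \<le> ennreal (1/2)"
    using exists_tail_bound by blast
  define D where "D = {A \<in> configs n. Max A \<le> L}"
  have "foster_chain kernel {..<n} height D (1/2) (real (Suc L))"
  proof
    have "D \<subseteq> Pow {..L}"
    proof
      fix A assume "A \<in> D"
      then have "finite A" "Max A \<le> L" by (auto simp: D_def configs_def)
      then show "A \<in> Pow {..L}" using Max_ge order_trans by blast
    qed
    then show "finite D" by (rule finite_subset) simp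
    fix A
    show "(\<integral>\<^sup>+B. height B \<partial>measure_pmf (kernel A)) + ennreal (1/2)
        \<le> ennreal (height A) + ennreal (real (Suc L)) * indicator D A"
    proof (cases "A \<in> configs n")
      case False
      have "height {..<n} = real (n - 1)"
      proof -
        have "Max {..<n} = n - 1" using n_pos by (intro Max_eqI) auto
        then show ?thesis by (simp add: height_def ground_config)
      qed
      then have "ennreal (height {..<n}) + ennreal (1/2) \<le> ennreal (real n)"
        using n_pos by (subst ennreal_plus[symmetric]) (auto intro!: ennreal_leI simp: of_nat_diff)
      then show ?thesis using False by (simp add: kernel_def height_def D_def)
    next
      case True
      show ?thesis
      proof (cases "A \<in> D")
        case in_D: True
        have "(\<integral>\<^sup>+B. height B \<partial>measure_pmf (kernel A)) + ennreal (1/2) \<le> of_nat (Suc L)"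
          using in_D by (intro height_after_step[OF tail]) (auto simp: D_def)
        then show ?thesis using in_D by (simp add: add_increasing ennreal_of_nat_eq_real_of_nat)
      next
        case False
        then have big: "Max A = Suc (Max A - 1)" "L \<le> Max A - 1" using True by (auto simp: D_def)
        have "(\<integral>\<^sup>+B. height B \<partial>measure_pmf (kernel A)) + ennreal (1/2) \<le> of_nat (Suc (Max A - 1))"
          using big by (intro height_after_step[OF tail True]) auto
        also have "\<dots> = ennreal (height A)"
          using True big(1) by (simp add: height_def ennreal_of_nat_eq_real_of_nat)
        finally show ?thesis using False by simp
      qed
    qed
  qed (auto simp: reach_ground ground_self_loop height_def)
  then show ?thesis by (rule that)
qed

end

section \<open>Convergence to equilibrium\<close>

theorem theorem2p2:
  fixes n :: nat and \<nu> :: "nat set \<Rightarrow> nat pmf"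
  assumes "n \<ge> 1"
    and "\<forall>B\<in>configs (n - 1). (\<Sum>y\<in>B. pmf (\<nu> B) y) = 0"
    and "uniformly_integrable_family (n - 1) \<nu>"
    and "\<forall>B\<in>configs (n - 1). pmf (\<nu> B) (LEAST y. y \<notin> B) > 0"
  shows "(\<exists>!\<pi>. equilibrium n \<nu> \<pi>) \<and>
    (\<forall>\<pi>. equilibrium n \<nu> \<pi> \<longrightarrow>
      (\<forall>A\<in>configs n.
        (\<lambda>t. \<Sum>\<^sub>\<infinity>B\<in>configs n. \<bar>jep_power n \<nu> t A B - pmf \<pi> B\<bar>) \<longlonglongrightarrow> 0))"
proof -
  interpret jep n \<nu> using assms by unfold_locales auto
  obtain D b where "foster_chain kernel {..<n} height D (1/2) b"
    using exists_foster_chain by blast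
  then obtain M where M: "bind_pmf M kernel = M"
    and unique: "\<And>M'. bind_pmf M' kernel = M' \<Longrightarrow> M' = M"
    and conv: "\<And>A. (\<lambda>t. l1_dist (walk kernel t A) M) \<longlonglongrightarrow> 0"
    by (rule foster_chain.unique_stationary_and_convergence) blast
  have supp: "set_pmf M \<subseteq> configs n" using M equilibrium_iff equilibrium_def by blast
  have limit: "(\<lambda>t. \<Sum>\<^sub>\<infinity>B\<in>configs n. \<bar>jep_power n \<nu> t A B - pmf M B\<bar>) \<longlonglongrightarrow> 0"
    if A: "A \<in> configs n" for A
  proof -
    have "(\<lambda>t. enn2real (l1_dist (walk kernel t A) M)) \<longlonglongrightarrow> 0"
      using tendsto_enn2real[OF conv[of A, folded ennreal_0]] by simp
    then show ?thesis
      by (simp only: jep_power_eq_walk[OF A] infsum_l1_dist[OF set_walk[OF A] supp])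
  qed
  have "equilibrium n \<nu> \<pi> \<longleftrightarrow> \<pi> = M" for \<pi>
    unfolding equilibrium_iff using M unique[of \<pi>] by blast
  then show ?thesis using limit by simp
qed

end
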